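(* Let $\sigma>1$ and $m\in\mathbb N\setminus\{1\}$. Call $N\in 2\mathbb N$ admissible if $N_1:=\sigma N\in 2\mathbb N$ and $2m<N_1$. For each admissible $N$ let a window function $\varphi=\varphi_N\in\Phi_{m,N_1}$ be given, and let $e_\sigma(\varphi)=\sup_N e_{\sigma,N}(\varphi)$ be the corresponding error constant. Then for every admissible $N$ and all coefficients $c_k\in\mathbb C$, $k\in I_N$, the error function $s-p$ of the NFFT satisfies $$\|s-p\|_{C(\mathbb T)}\le e_\sigma(\varphi)\sum_{n\in I_N}|c_n|.$$
   Context: $\mathbb N=\{1,2,\dots\}$, $\mathbb T=\mathbb R/\mathbb Z$, $C(\mathbb T)$ is the space of continuous $1$-periodic functions with the sup-norm, $I_N:=\{-N/2,\dots,N/2-1\}$ for $N\in2\mathbb N$. With $N_1=\sigma N$ and the open interval $I:=(-\frac m{N_1},\frac m{N_1})$, $\Phi_{m,N_1}$ denotes the set of functions $\varphi:\mathbb R\to[0,1]$ such that: $\varphi$ is even, continuous on $\mathbb R$, with support $\bar I$; $\varphi|_{[0,m/N_1]}$ is decreasing with $\varphi(0)=1$; and the Fourier transform $\hat\varphi(v):=\int_I\varphi(t)e^{-2\pi i vt}\,dt$ is positive for all $v\in[-N/2,N/2]$. The error constants are $$e_{\sigma,N}(\varphi):=\max_{n\in I_N}\Big\|\sum_{r\in\mathbb Z\setminus\{0\}}\frac{\hat\varphi(n+rN_1)}{\hat\varphi(n)}e^{2\pi i rN_1\,\cdot}\Big\|_{C(\mathbb T)},\qquad e_\sigma(\varphi):=\sup_N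 e_{\sigma,N}(\varphi),$$ the supremum being over admissible $N$ (for each $N$ the window function with parameters $m$ and $N_1=\sigma N$ is used; the inequality is void if $e_\sigma(\varphi)=+\infty$). Series over $r$ are understood as limits of symmetric partial sums. Given $c_k\in\mathbb C$ ($k\in I_N$), put $p(x):=\sum_{k\in I_N}c_ke^{2\pi i kx}$, $\tilde\varphi(x):=\sum_{k\in\mathbb Z}\varphi(x+k)$, $$g_\ell:=\frac1{N_1}\sum_{k\in I_N}\frac{c_k}{\hat\varphi(k)}e^{2\pi i k\ell/N_1}\ (\ell\in I_{N_1}),\qquad s(x):=\sum_{\ell\in I_{N_1}}g_\ell\,\tilde\varphi\Big(x-\frac{\ell}{N_1}\Big).$$ *)

theory Defs
  imports "HOL-Analysis.Analysis"
begin

definition index_set :: "nat \<Rightarrow> int set" where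
  "index_set N = {- (int N div 2) .. int N div 2 - 1}"

definition admissible :: "real \<Rightarrow> nat \<Rightarrow> nat \<Rightarrow> bool" where
  "admissible \<sigma> m N \<longleftrightarrow> N > 0 \<and> even N
     \<and> (\<exists>M::nat. M > 0 \<and> even M \<and> real M = \<sigma> * real N)
     \<and> 2 * real m < \<sigma> * real N"

text \<open>For admissible \<open>N\<close> the rounding is vacuous: \<open>real (oversampled \<sigma> N) = \<sigma> * real N\<close>.\<close>

definition oversampled :: "real \<Rightarrow> nat \<Rightarrow> nat" where
  "oversampled \<sigma> N = nat \<lfloor>\<sigma> * real N\<rfloor>"

definition window_interval :: "nat \<Rightarrow> nat \<Rightarrow> real set" where
  "window_interval m N1 = {- (real m / real N1) <..< real m / real N1}"

definition fourier_hat :: "nat \<Rightarrow> nat \<Rightarrow> (real \<Rightarrow> real) \<Rightarrow> real \<Rightarrow> complex" where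
  "fourier_hat m N1 \<phi> v =
     set_lebesgue_integral lborel (window_interval m N1)
       (\<lambda>t. complex_of_real (\<phi> t) * cis (- 2 * pi * v * t))"

text \<open>
  The set \<open>\<Phi>\<close> of window functions with parameters \<open>m\<close> and \<open>N1\<close>; \<open>N\<close> enters through the frequency
  range on which the Fourier transform is positive. ``Decreasing'' is understood in the weak sense.
\<close>

definition windows :: "nat \<Rightarrow> nat \<Rightarrow> nat \<Rightarrow> (real \<Rightarrow> real) set" where
  "windows m N N1 = {\<phi>.
     range \<phi> \<subseteq> {0..1} \<and>
     (\<forall>t. \<phi> (- t) = \<phi> t) \<and>
     continuous_on UNIV \<phi> \<and>
     closure {t. \<phi> t \<noteq> 0} = closure (window_interval m N1) \<and>
     antimono_on {0 .. real m / real N1} \<phi> \<and>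
     \<phi> 0 = 1 \<and>
     (\<forall>v \<in> {- (real N / 2) .. real N / 2}.
        fourier_hat m N1 \<phi> v \<in> \<real> \<and> Re (fourier_hat m N1 \<phi> v) > 0)}"

text \<open>
  Functions on \<open>\<real>/\<int>\<close> are 1-periodic functions on the reals. The norm takes values in \<open>[0,\<infinity>]\<close>, so
  that it needs no boundedness side condition; on continuous 1-periodic functions it is the usual
  finite maximum norm.
\<close>

definition sup_norm :: "(real \<Rightarrow> complex) \<Rightarrow> ennreal" where
  "sup_norm f = (SUP x. ennreal (cmod (f x)))"

text \<open>
  The limit of the symmetric partial sums exists (uniformly in \<open>x\<close>) for every window function by the
  Dirichlet-Jordan theorem: after multiplication by \<open>N1 * fourier_hat m N1 \<phi> n\<close> and with the term
  \<open>r = 0\<close> added, this is the Fourier series of the \<open>1/N1\<close>-periodization of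
  \<open>\<phi>(x) e^{-2 \<pi> i n x}\<close>, which is continuous and of bounded variation.
\<close>

definition aliasing_series :: "nat \<Rightarrow> nat \<Rightarrow> (real \<Rightarrow> real) \<Rightarrow> int \<Rightarrow> real \<Rightarrow> complex" where
  "aliasing_series m N1 \<phi> n x =
     lim (\<lambda>R::nat. \<Sum>r \<in> {- int R .. int R} - {0}.
       fourier_hat m N1 \<phi> (of_int (n + r * int N1)) / fourier_hat m N1 \<phi> (of_int n)
         * cis (2 * pi * of_int r * real N1 * x))"

definition error_const_N :: "real \<Rightarrow> nat \<Rightarrow> nat \<Rightarrow> (real \<Rightarrow> real) \<Rightarrow> ennreal" where
  "error_const_N \<sigma> m N \<phi> =
     (MAX n \<in> index_set N. sup_norm (aliasing_series m (oversampled \<sigma> N) \<phi> n))"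

definition error_const :: "real \<Rightarrow> nat \<Rightarrow> (nat \<Rightarrow> real \<Rightarrow> real) \<Rightarrow> ennreal" where
  "error_const \<sigma> m \<phi> = (SUP N \<in> {N. admissible \<sigma> m N}. error_const_N \<sigma> m N (\<phi> N))"

definition trig_poly :: "nat \<Rightarrow> (int \<Rightarrow> complex) \<Rightarrow> real \<Rightarrow> complex" where
  "trig_poly N c x = (\<Sum>k \<in> index_set N. c k * cis (2 * pi * of_int k * x))"

definition periodization :: "(real \<Rightarrow> real) \<Rightarrow> real \<Rightarrow> real" where
  "periodization \<phi> x = (\<Sum>\<^sub>\<infinity>k::int. \<phi> (x + of_int k))"

definition nfft_coeff ::
    "nat \<Rightarrow> nat \<Rightarrow> nat \<Rightarrow> (real \<Rightarrow> real) \<Rightarrow> (int \<Rightarrow> complex) \<Rightarrow> int \<Rightarrow> complex" where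
  "nfft_coeff m N N1 \<phi> c l =
     1 / of_nat N1 * (\<Sum>k \<in> index_set N.
       c k / fourier_hat m N1 \<phi> (of_int k) * cis (2 * pi * of_int k * of_int l / real N1))"

definition nfft_approx ::
    "nat \<Rightarrow> nat \<Rightarrow> nat \<Rightarrow> (real \<Rightarrow> real) \<Rightarrow> (int \<Rightarrow> complex) \<Rightarrow> real \<Rightarrow> complex" where
  "nfft_approx m N N1 \<phi> c x =
     (\<Sum>l \<in> index_set N1.
       nfft_coeff m N N1 \<phi> c l * complex_of_real (periodization \<phi> (x - of_int l / real N1)))"

end

theory Submission
  imports Defs "HOL-Real_Asymp.Real_Asymp"
begin

text \<open>
  Everything rests on an exact formula for the error. For one frequency \<open>n\<close>, the sum over the
  nodes \<open>l\<close> and the sum over the integer shifts in the periodization together form one sum over all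
  integers: with \<open>e t = cis (2 * pi * t)\<close> and \<open>F\<close> for the Fourier transform of the window,
  \<open>s x\<close> is the sum of \<open>c n / (N1 * F n) * S n x\<close> over \<open>n\<close>, where

  \<open>S n x = (\<Sum>j. \<phi> (x - j / N1) * e (n * j / N1))\<close>.

  Poisson summation expresses the same quantity by the Fourier transform,

  \<open>S n x = N1 * e (n * x) * (\<Sum>r. F (n + r * N1) * e (r * N1 * x))\<close>.

  After division by \<open>N1 * F n\<close>, the term \<open>r = 0\<close> is the exponential \<open>e (n * x)\<close> of the polynomial
  \<open>p\<close>, and the other terms are \<open>e (n * x)\<close> times the aliasing series. Hence \<open>s - p\<close> is the sum over \<open>n\<close>
  of \<open>c n * e (n * x)\<close> times the aliasing series of \<open>n\<close> (\<open>nfft_error_eq\<close>), and the estimate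
  is the triangle inequality.

  The difficulty lies in Poisson summation: the window is only continuous and monotone on either side
  of the origin, its Fourier series need not converge absolutely, and the aliasing series is a limit
  of symmetric partial sums. That limit has to be shown to exist at every point, with the correct
  value; this is a case of the Dirichlet-Jordan theorem. The symmetric partial sums are integrals
  against the Dirichlet kernel, and the proof has three ingredients.

  \<^item> The primitive of the Dirichlet kernel converges to \<open>\<lfloor>u\<rfloor> + 1 / 2\<close> off the integers and
    stays within bounded distance of \<open>u\<close> (\<open>dirichlet_primitive_tendsto\<close>,
    \<open>dirichlet_primitive_bound\<close>).
  \<^item> For a continuously differentiable \<open>w\<close> on an interval, integration by parts and dominated
    convergence turn this into the sum of \<open>w\<close> over the integers of the interval, with bounds that
    are uniform over intervals in a compact set (\<open>dirichlet_integral_tendsto\<close>,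
    \<open>dirichlet_integral_bounded\<close>).
  \<^item> A unimodal function \<open>f\<close> is the integral over \<open>y\<close> of the indicators of the level sets
    \<open>y < f u\<close>, which are intervals. Exchanging the integrals and using dominated convergence in
    \<open>y\<close> yields the result for \<open>f * w\<close> (\<open>poisson_summation_level_intervals\<close>).
\<close>


section \<open>The Dirichlet kernel and its primitive\<close>

definition dirichlet_kernel :: "nat \<Rightarrow> real \<Rightarrow> real" where
  "dirichlet_kernel R u = 1 + 2 * (\<Sum>r = 1..R. cos (2 * pi * real r * u))"

text \<open>
  The constant of integration makes the primitive odd. Since its non-linear part has period 1, it
  only has to be studied on \<open>[0, 1/2]\<close>.
\<close>

definition dirichlet_primitive :: "nat \<Rightarrow> real \<Rightarrow> real" where
  "dirichlet_primitive R u = u + (\<Sum>r = 1..R. sin (2 * pi * real r * u) / (pi * real r))"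

lemma dirichlet_primitive_deriv:
  "(dirichlet_primitive R has_real_derivative dirichlet_kernel R u) (at u)"
  unfolding dirichlet_primitive_def dirichlet_kernel_def sum_distrib_left
  by (auto intro!: derivative_eq_intros sum.cong)

lemma continuous_on_dirichlet_kernel [continuous_intros]:
  "continuous_on A (dirichlet_kernel R)"
  unfolding dirichlet_kernel_def by (intro continuous_intros)

lemma continuous_on_dirichlet_primitive [continuous_intros]:
  "continuous_on A (dirichlet_primitive R)"
  using dirichlet_primitive_deriv DERIV_continuous_on has_field_derivative_at_within by blast

lemma measurable_dirichlet_kernel [measurable]: "dirichlet_kernel R \<in> borel_measurable borel"
  by (intro borel_measurable_continuous_onI continuous_on_dirichlet_kernel)

lemma measurable_dirichlet_primitive [measurable]:
  "dirichlet_primitive R \<in> borel_measurable borel"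
  by (intro borel_measurable_continuous_onI continuous_on_dirichlet_primitive)

lemma sum_cis_symmetric:
  "(\<Sum>r \<in> {- int R..int R}. cis (2 * pi * of_int r * u)) = of_real (dirichlet_kernel R u)"
proof (induction R)
  case 0
  then show ?case by (simp add: dirichlet_kernel_def)
next
  case (Suc R)
  have *: "{- int (Suc R)..int (Suc R)}
      = insert (int (Suc R)) (insert (- int (Suc R)) {- int R..int R})"
    by auto
  show ?case
    unfolding *
    by (simp add: Suc.IH del: of_nat_Suc)
       (simp add: dirichlet_kernel_def complex_eq_iff distrib_left del: of_nat_Suc)
qed

lemma sin_mult_dirichlet_kernel:
  "sin (pi * u) * dirichlet_kernel R u = sin ((2 * real R + 1) * (pi * u))"
proof (induction R)
  case 0
  then show ?case by (simp add: dirichlet_kernel_def)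
next
  case (Suc R)
  have "2 * sin (pi * u) * cos (2 * pi * real (Suc R) * u)
      = sin ((2 * real (Suc R) + 1) * (pi * u)) - sin ((2 * real R + 1) * (pi * u))"
  proof -
    let ?z = "2 * pi * real (Suc R) * u"
    have "(2 * real (Suc R) + 1) * (pi * u) = ?z + pi * u"
      "(2 * real R + 1) * (pi * u) = ?z - pi * u"
      by (simp_all add: algebra_simps)
    then show ?thesis by (simp only: sin_add sin_diff) simp
  qed
  then show ?case
    using Suc by (simp add: dirichlet_kernel_def algebra_simps)
qed

lemma dirichlet_primitive_add_int:
  "dirichlet_primitive R (u + of_int k) = dirichlet_primitive R u + of_int k"
proof -
  have "sin (2 * pi * real r * (u + of_int k)) = sin (2 * pi * real r * u)" for r
  proof -
    have "2 * pi * real r * (u + of_int k) = 2 * pi * real r * u + 2 * pi * of_int (int r * k)"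
      by (simp add: algebra_simps)
    moreover have "sin (2 * pi * of_int (int r * k)) = 0" "cos (2 * pi * of_int (int r * k)) = 1"
      by (simp_all only: sin_int_2pin cos_int_2pin)
    ultimately show ?thesis
      by (simp only: sin_add)
  qed
  then show ?thesis
    by (simp add: dirichlet_primitive_def)
qed

lemma dirichlet_primitive_minus: "dirichlet_primitive R (- u) = - dirichlet_primitive R u"
  by (simp add: dirichlet_primitive_def sum_negf)

text \<open>
  A weak form of Jordan's inequality, read off from the cubic Taylor estimate of the sine: on
  \<open>[0, pi/2]\<close> the cubic term is at most half of the linear one.
\<close>

lemma le_sin_pi_mult:
  fixes u :: real
  assumes "0 < u" "u \<le> 1 / 2"
  shows "u \<le> sin (pi * u)"
proof -
  let ?x = "pi * u"
  have x: "0 \<le> ?x" "?x \<le> pi / 2" using assms by auto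
  have "\<bar>sin ?x - ?x\<bar> \<le> ?x ^ 3 / 6"
    using Maclaurin_sin_bound[of ?x 3] x
    by (simp add: sin_coeff_def numeral_3_eq_3 fact_numeral power_abs)
  moreover have "?x ^ 3 \<le> ?x * 3"
  proof -
    have "?x ^ 2 \<le> (pi / 2) ^ 2" using x by (intro power_mono) auto
    also have "\<dots> \<le> (3.2 / 2) ^ 2" using pi_less_4 pi_approx by (intro power_mono) auto
    also have "\<dots> \<le> 3" by (simp add: power2_eq_square)
    finally have "?x * ?x^2 \<le> ?x * 3" using x by (intro mult_left_mono) auto
    then show ?thesis by (simp add: power_numeral_reduce)
  qed
  ultimately have "sin ?x \<ge> ?x / 2" by linarith
  moreover have "u * 2 \<le> u * pi" using assms pi_ge_two by (intro mult_left_mono) auto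
  ultimately show ?thesis by (simp add: mult.commute)
qed

text \<open>
  The primitive equals \<open>1/2\<close> at \<open>1/2\<close>, and its derivative is
  \<open>sin ((2 * R + 1) * pi * v) / sin (pi * v)\<close>. One integration by parts, integrating the fast
  oscillation, gains the factor \<open>1 / (2 * R + 1)\<close> at the price of a singularity at \<open>0\<close>. The
  integration by parts is carried out on the level of primitives: adding the boundary term to the
  primitive gives a function \<open>h\<close> whose derivative is dominated by that of the monotone function
  \<open>- g\<close>, so both \<open>h + g\<close> and \<open>h - g\<close> are monotone on \<open>[u, 1/2]\<close>.
\<close>

lemma dirichlet_primitive_near_half:
  assumes "0 < u" "u \<le> 1 / 2"
  shows "\<bar>dirichlet_primitive R u - 1 / 2\<bar> \<le> 2 / ((2 * real R + 1) * pi * u)"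
proof -
  define k where "k = 2 * real R + 1"
  have k: "k > 0" by (simp add: k_def)
  define h where "h v = dirichlet_primitive R v + cos (k * (pi * v)) / (k * pi * sin (pi * v))" for v
  define g where "g v = 1 / (k * pi * sin (pi * v))" for v
  have sin_pos: "sin (pi * v) > 0" if "u \<le> v" "v \<le> 1 / 2" for v
    using le_sin_pi_mult[of v] that assms by simp
  define h' where "h' v = - (cos (k * (pi * v)) * cos (pi * v) / (k * (sin (pi * v))\<^sup>2))" for v
  define g' where "g' v = - (cos (pi * v) / (k * (sin (pi * v))\<^sup>2))" for v
  have dg: "(g has_real_derivative g' v) (at v)" if "u \<le> v" "v \<le> 1 / 2" for v
    unfolding g_def g'_def using sin_pos[OF that] k
    by (auto intro!: derivative_eq_intros simp: field_simps power2_eq_square)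
  have dh: "(h has_real_derivative h' v) (at v)" if "u \<le> v" "v \<le> 1 / 2" for v
  proof -
    have s: "sin (pi * v) > 0" by (rule sin_pos[OF that])
    have D: "dirichlet_kernel R v = sin (k * (pi * v)) / sin (pi * v)"
      using sin_mult_dirichlet_kernel[of v R] s by (simp add: k_def field_simps)
    show ?thesis
      unfolding h_def h'_def
      using s k
      by (auto intro!: derivative_eq_intros dirichlet_primitive_deriv
          simp: D field_simps power2_eq_square)
  qed
  \<comment> \<open>The two derivatives differ by a factor that is a cosine.\<close>
  have dom: "\<bar>h' v\<bar> \<le> - g' v" if "u \<le> v" "v \<le> 1 / 2" for v
  proof -
    have c: "cos (pi * v) \<ge> 0"
      using that assms by (intro cos_ge_zero) (auto intro: order_trans[of _ 0])
    have "\<bar>h' v\<bar> = \<bar>cos (k * (pi * v))\<bar> * (cos (pi * v) / (k * (sin (pi * v))\<^sup>2))"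
      using c k by (simp add: h'_def abs_mult)
    also have "\<dots> \<le> 1 * (cos (pi * v) / (k * (sin (pi * v))\<^sup>2))"
      using c k by (intro mult_right_mono) auto
    finally show ?thesis by (simp add: g'_def)
  qed
  have half_k: "cos (k * (pi * (1 / 2))) = 0"
  proof -
    have "k * (pi * (1/2)) = pi * real R + pi / 2" by (simp add: k_def algebra_simps)
    then show ?thesis by (simp only: cos_add) auto
  qed
  have half_Q: "dirichlet_primitive R (1 / 2) = 1 / 2"
    by (simp add: dirichlet_primitive_def)
  have h_half: "h (1 / 2) = 1 / 2"
    using half_k half_Q by (simp add: h_def)
  have "h (1 / 2) + g (1 / 2) \<le> h u + g u"
  proof (rule DERIV_nonpos_imp_nonincreasing[where f = "\<lambda>v. h v + g v"])
    fix v assume v: "u \<le> v" "v \<le> 1 / 2"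
    then show "\<exists>y. ((\<lambda>v. h v + g v) has_real_derivative y) (at v) \<and> y \<le> 0"
      using DERIV_add[OF dh[OF v] dg[OF v]] dom[OF v] by (intro exI[of _ "h' v + g' v"]) auto
  qed (use assms in auto)
  moreover have "h u - g u \<le> h (1 / 2) - g (1 / 2)"
  proof (rule DERIV_nonneg_imp_nondecreasing[where f = "\<lambda>v. h v - g v"])
    fix v assume v: "u \<le> v" "v \<le> 1 / 2"
    then show "\<exists>y. ((\<lambda>v. h v - g v) has_real_derivative y) (at v) \<and> y \<ge> 0"
      using DERIV_diff[OF dh[OF v] dg[OF v]] dom[OF v] by (intro exI[of _ "h' v - g' v"]) auto
  qed (use assms in auto)
  moreover have "g (1 / 2) \<ge> 0" using k by (simp add: g_def)
  ultimately have hg: "\<bar>h u - 1 / 2\<bar> \<le> g u"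
    using h_half by (simp add: abs_le_iff)
  have su: "u \<le> sin (pi * u)" by (rule le_sin_pi_mult) fact+
  have "\<bar>cos (k * (pi * u)) / (k * pi * sin (pi * u))\<bar> \<le> g u"
    unfolding g_def abs_divide using su assms k by (intro frac_le) auto
  then have "\<bar>dirichlet_primitive R u - 1 / 2\<bar> \<le> 2 * g u"
    using hg unfolding h_def abs_le_iff by (intro conjI) linarith+
  also have "\<dots> \<le> 2 / (k * pi * u)"
    unfolding g_def using su assms k by (auto intro!: divide_left_mono mult_left_mono)
  finally show ?thesis by (simp add: k_def)
qed

text \<open>
  For \<open>u \<le> 1 / R\<close> the \<open>R\<close> summands are bounded by \<open>2 * u\<close> each; for larger \<open>u\<close> the estimate near
  \<open>1 / 2\<close> is already bounded.
\<close>

lemma dirichlet_primitive_bound_half: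
  assumes "0 \<le> u" "u \<le> 1 / 2"
  shows "\<bar>dirichlet_primitive R u - u\<bar> \<le> 2"
proof (cases "real R * u \<le> 1")
  case True
  have "\<bar>dirichlet_primitive R u - u\<bar> \<le> (\<Sum>r = 1..R. \<bar>sin (2 * pi * real r * u) / (pi * real r)\<bar>)"
    unfolding dirichlet_primitive_def add_diff_cancel_left' by (rule sum_abs)
  also have "\<dots> \<le> (\<Sum>r = 1..R. 2 * u)"
  proof (rule sum_mono)
    fix r assume "r \<in> {1..R}"
    then show "\<bar>sin (2 * pi * real r * u) / (pi * real r)\<bar> \<le> 2 * u"
      using abs_sin_x_le_abs_x[of "2 * pi * real r * u"] assms
      by (auto simp: abs_mult field_simps)
  qed
  also have "\<dots> \<le> 2" using True by simp
  finally show ?thesis .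
next
  case False
  then have u: "u > 0" using assms by (cases "u = 0") auto
  have "2 * 2 \<le> (2 * real R + 1) * u * pi"
    using False u pi_ge_two by (intro mult_mono) (auto simp: algebra_simps)
  then have "2 / ((2 * real R + 1) * pi * u) \<le> 1"
    using u by (simp add: field_simps)
  then have "\<bar>dirichlet_primitive R u - 1 / 2\<bar> \<le> 1"
    using dirichlet_primitive_near_half[of u R] u assms by linarith
  then show ?thesis using assms by linarith
qed

lemma dirichlet_primitive_bound: "\<bar>dirichlet_primitive R u - u\<bar> \<le> 2"
proof -
  define k where "k = round u"
  define v where "v = u - of_int k"
  have v: "\<bar>v\<bar> \<le> 1 / 2"
    using of_int_round_abs_le[of u] by (simp add: v_def k_def abs_minus_commute)
  have "\<bar>dirichlet_primitive R v - v\<bar> \<le> 2"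
  proof (cases "v \<ge> 0")
    case False
    then show ?thesis
      using dirichlet_primitive_bound_half[of "- v" R] v by (simp add: dirichlet_primitive_minus)
  qed (use dirichlet_primitive_bound_half v in auto)
  then show ?thesis
    using dirichlet_primitive_add_int[of R v k] by (simp add: v_def)
qed

lemma dirichlet_primitive_tendsto:
  assumes "u \<notin> \<int>"
  shows "(\<lambda>R. dirichlet_primitive R u) \<longlonglongrightarrow> of_int \<lfloor>u\<rfloor> + 1 / 2"
proof -
  have half: "(\<lambda>R. dirichlet_primitive R v) \<longlonglongrightarrow> 1 / 2" if "0 < v" "v \<le> 1 / 2" for v
  proof -
    have "(\<lambda>R. 2 / ((2 * real R + 1) * pi * v)) \<longlonglongrightarrow> 0"
      using that by real_asymp
    then have "(\<lambda>R. dirichlet_primitive R v - 1 / 2) \<longlonglongrightarrow> 0"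
      by (rule Lim_null_comparison[rotated])
         (use dirichlet_primitive_near_half[OF that] in auto)
    then show ?thesis by (rule LIM_zero_cancel)
  qed
  define v where "v = frac u"
  have v: "0 < v" "v < 1"
    using assms by (auto simp: v_def frac_gt_0_iff frac_lt_1)
  have "(\<lambda>R. dirichlet_primitive R v) \<longlonglongrightarrow> 1 / 2"
  proof (cases "v \<le> 1 / 2")
    case False
    have "dirichlet_primitive R v = 1 - dirichlet_primitive R (1 - v)" for R
      using dirichlet_primitive_add_int[of R "- v" 1] by (simp add: dirichlet_primitive_minus)
    then show ?thesis
      using tendsto_diff[OF tendsto_const[of 1] half[of "1 - v"]] False v by simp
  qed (use half v in auto)
  then have "(\<lambda>R. dirichlet_primitive R v + of_int \<lfloor>u\<rfloor>) \<longlonglongrightarrow> 1 / 2 + of_int \<lfloor>u\<rfloor>"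
    by (intro tendsto_add tendsto_const)
  moreover have "v + of_int \<lfloor>u\<rfloor> = u" by (simp add: v_def frac_def)
  ultimately show ?thesis
    using dirichlet_primitive_add_int[of _ v "\<lfloor>u\<rfloor>"] by (simp add: add.commute)
qed

section \<open>Integrals of smooth functions against the Dirichlet kernel\<close>

text \<open>
  The integral of the kernel is traded for its primitive, which converges boundedly, while the kernel
  itself does not converge.
\<close>

lemma set_integral_by_parts_dirichlet:
  fixes w w' :: "real \<Rightarrow> complex"
  assumes "b \<le> d"
    and w: "\<And>u. (w has_vector_derivative w' u) (at u)" and w': "continuous_on UNIV w'"
  shows "(LINT u:{b..d}|lborel. w u * of_real (dirichlet_kernel R u))
    = w d * of_real (dirichlet_primitive R d) - w b * of_real (dirichlet_primitive R b)
      - (LINT u:{b..d}|lborel. w' u * of_real (dirichlet_primitive R u))"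
proof -
  let ?Q = "\<lambda>u. complex_of_real (dirichlet_primitive R u)"
  let ?D = "\<lambda>u. complex_of_real (dirichlet_kernel R u)"
  have cw: "continuous_on A w" for A
    using w by (meson continuous_at_imp_continuous_on has_vector_derivative_continuous)
  have cw': "continuous_on A w'" for A
    using w' continuous_on_subset by blast
  have "((\<lambda>v. w v * ?Q v) has_vector_derivative (w u * ?D u + w' u * ?Q u)) (at u)" for u
    by (intro has_vector_derivative_mult w has_vector_derivative_of_real
        has_real_derivative_iff_has_vector_derivative[THEN iffD1] dirichlet_primitive_deriv)
  then have "(LINT u:{b..d}|lborel. w u * ?D u + w' u * ?Q u) = w d * ?Q d - w b * ?Q b"
    unfolding set_lebesgue_integral_def
    by (intro integral_FTC_atLeastAtMost[OF \<open>b \<le> d\<close>])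
       (auto intro!: continuous_intros cw cw' intro: has_vector_derivative_at_within)
  moreover have "(LINT u:{b..d}|lborel. w u * ?D u + w' u * ?Q u)
      = (LINT u:{b..d}|lborel. w u * ?D u) + (LINT u:{b..d}|lborel. w' u * ?Q u)"
    by (intro set_integral_add borel_integrable_atLeastAtMost' continuous_intros cw cw')
  ultimately show ?thesis by (simp add: algebra_simps)
qed

text \<open>
  Euler's summation formula: on \<open>[b, d]\<close> the floor is \<open>\<lfloor>b\<rfloor>\<close> plus a unit step at each integer of
  \<open>(b, d]\<close>, and a step at \<open>j\<close> contributes \<open>w d - w j\<close> to the integral. This identifies the limit of
  the integrals against the Dirichlet kernel as a sum over integers.
\<close>

lemma euler_summation:
  fixes w w' :: "real \<Rightarrow> complex"
  assumes "b \<le> d"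
    and w: "\<And>u. (w has_vector_derivative w' u) (at u)" and w': "continuous_on UNIV w'"
  shows "w d * of_real (of_int \<lfloor>d\<rfloor> + 1 / 2) - w b * of_real (of_int \<lfloor>b\<rfloor> + 1 / 2)
      - (LINT u:{b..d}|lborel. w' u * of_real (of_int \<lfloor>u\<rfloor> + 1 / 2))
    = (\<Sum>j \<in> {\<lfloor>b\<rfloor> + 1..\<lfloor>d\<rfloor>}. w (of_int j))"
proof -
  let ?J = "{\<lfloor>b\<rfloor> + 1..\<lfloor>d\<rfloor>}"
  let ?h = "complex_of_real (of_int \<lfloor>b\<rfloor> + 1 / 2)"
  have cw': "continuous_on A w'" for A
    using w' continuous_on_subset by blast
  have ftc: "(LINT u:{a..d}|lborel. w' u) = w d - w a" if "a \<le> d" for a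
    unfolding set_lebesgue_integral_def
    by (intro integral_FTC_atLeastAtMost that cw') (rule has_vector_derivative_at_within[OF w])
  have floor_steps: "of_int \<lfloor>u\<rfloor> = (of_int \<lfloor>b\<rfloor> :: real) + (\<Sum>j\<in>?J. if of_int j \<le> u then 1 else 0)"
    if "u \<in> {b..d}" for u
  proof -
    have "(\<Sum>j\<in>?J. if of_int j \<le> u then 1 else 0 :: real) = of_nat (card {j \<in> ?J. of_int j \<le> u})"
      by (simp add: sum.If_cases Int_def)
    also have "{j \<in> ?J. of_int j \<le> u} = {\<lfloor>b\<rfloor> + 1..\<lfloor>u\<rfloor>}"
      using that floor_mono[of u d] by (auto simp: le_floor_iff)
    finally show ?thesis using that floor_mono[of b u] by simp
  qed
  have in_J: "b \<le> of_int j" "of_int j \<le> d" if "j \<in> ?J" for j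
    using that by (auto simp: le_floor_iff) linarith
  have int_h: "integrable lborel (\<lambda>u. indicator {b..d} u *\<^sub>R (w' u * ?h))"
    by (intro borel_integrable_compact continuous_intros cw' compact_Icc)
  have int_J: "integrable lborel (\<lambda>u. indicator {of_int j..d} u *\<^sub>R w' u)" for j
    by (intro borel_integrable_compact cw' compact_Icc)
  have "(LINT u:{b..d}|lborel. w' u * of_real (of_int \<lfloor>u\<rfloor> + 1 / 2))
      = (LINT u|lborel. indicator {b..d} u *\<^sub>R (w' u * ?h)
          + (\<Sum>j\<in>?J. indicator {of_int j..d} u *\<^sub>R w' u))"
    unfolding set_lebesgue_integral_def
  proof (rule Bochner_Integration.integral_cong[OF refl])
    fix u :: real
    show "indicator {b..d} u *\<^sub>R (w' u * complex_of_real (of_int \<lfloor>u\<rfloor> + 1 / 2))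
      = indicator {b..d} u *\<^sub>R (w' u * ?h) + (\<Sum>j\<in>?J. indicator {of_int j..d} u *\<^sub>R w' u)"
    proof (cases "u \<in> {b..d}")
      case True
      have "(\<Sum>j\<in>?J. indicator {of_int j..d} u *\<^sub>R w' u)
          = complex_of_real (\<Sum>j\<in>?J. if of_int j \<le> u then 1 else 0) * w' u"
        using True by (auto simp: sum_distrib_right indicator_def intro!: sum.cong)
      also have "(\<Sum>j\<in>?J. if of_int j \<le> u then 1 else 0) = of_int \<lfloor>u\<rfloor> - (of_int \<lfloor>b\<rfloor> :: real)"
        using floor_steps[OF True] by linarith
      finally show ?thesis
        using True by (simp add: algebra_simps)
    next
      case False
      then have "(\<Sum>j\<in>?J. indicator {of_int j..d} u *\<^sub>R w' u) = 0"
        using in_J by (intro sum.neutral) (fastforce simp: indicator_def)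
      with False show ?thesis by simp
    qed
  qed
  also have "\<dots> = (LINT u:{b..d}|lborel. w' u * ?h) + (\<Sum>j\<in>?J. LINT u:{of_int j..d}|lborel. w' u)"
    unfolding set_lebesgue_integral_def
    by (simp only: Bochner_Integration.integral_add[OF int_h Bochner_Integration.integrable_sum[OF int_J]]
        Bochner_Integration.integral_sum[OF int_J])
  also have "\<dots> = (w d - w b) * ?h + (\<Sum>j\<in>?J. w d - w (of_int j))"
    using in_J \<open>b \<le> d\<close> by (simp add: ftc)
  also have "(\<Sum>j\<in>?J. w d - w (of_int j)) = of_int (\<lfloor>d\<rfloor> - \<lfloor>b\<rfloor>) * w d - (\<Sum>j\<in>?J. w (of_int j))"
    using floor_mono[OF \<open>b \<le> d\<close>] by (simp add: sum_subtractf)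
  finally have eq: "(LINT u:{b..d}|lborel. w' u * of_real (of_int \<lfloor>u\<rfloor> + 1 / 2))
      = (w d - w b) * ?h + (of_int (\<lfloor>d\<rfloor> - \<lfloor>b\<rfloor>) * w d - (\<Sum>j\<in>?J. w (of_int j)))" .
  show ?thesis
    unfolding eq by (simp add: field_simps)
qed

lemma dirichlet_primitive_abs_bound:
  assumes "\<bar>u\<bar> \<le> L"
  shows "\<bar>dirichlet_primitive R u\<bar> \<le> L + 2"
  using dirichlet_primitive_bound[of R u] assms by linarith

text \<open>
  The constant does not depend on the order of the kernel or on the interval. This supplies the
  dominating function for the limit under the integral over all level sets.
\<close>

lemma dirichlet_integral_bounded:
  fixes w w' :: "real \<Rightarrow> complex"
  assumes w: "\<And>u. (w has_vector_derivative w' u) (at u)" and w': "continuous_on UNIV w'"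
  obtains C where "\<And>R b d. -L \<le> b \<Longrightarrow> b \<le> d \<Longrightarrow> d \<le> L \<Longrightarrow>
    norm (LINT u:{b..d}|lborel. w u * of_real (dirichlet_kernel R u)) \<le> C"
proof -
  have cw: "continuous_on A w" for A
    using w by (meson continuous_at_imp_continuous_on has_vector_derivative_continuous)
  have cw': "continuous_on A w'" for A
    using w' continuous_on_subset by blast
  have "bounded (w ` {-L..L})"
    by (intro compact_imp_bounded compact_continuous_image cw compact_Icc)
  then obtain K where K: "\<And>u. u \<in> {-L..L} \<Longrightarrow> norm (w u) \<le> K"
    unfolding bounded_iff by blast
  have "bounded (w' ` {-L..L})"
    by (intro compact_imp_bounded compact_continuous_image cw' compact_Icc)
  then obtain K' where K': "\<And>u. u \<in> {-L..L} \<Longrightarrow> norm (w' u) \<le> K'"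
    unfolding bounded_iff by blast
  define C where "C = K * (L + 2) + K * (L + 2) + (2 * L) * (K' * (L + 2))"
  have "norm (LINT u:{b..d}|lborel. w u * of_real (dirichlet_kernel R u)) \<le> C"
    if bd: "-L \<le> b" "b \<le> d" "d \<le> L" for R b d
  proof -
    let ?Q = "\<lambda>u. complex_of_real (dirichlet_primitive R u)"
    have L: "L \<ge> 0" and K0: "K \<ge> 0" and K'0: "K' \<ge> 0"
      using bd order_trans[OF norm_ge_zero K[of b]] order_trans[OF norm_ge_zero K'[of b]] by auto
    have Q: "norm (?Q u) \<le> L + 2" if "u \<in> {-L..L}" for u
      using dirichlet_primitive_abs_bound[of u L R] that by auto
    have "norm (LINT u:{b..d}|lborel. w' u * ?Q u) \<le> (LINT u:{b..d}|lborel. K' * (L + 2))"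
      unfolding set_lebesgue_integral_def
    proof (rule Bochner_Integration.integral_norm_bound_integral)
      show "integrable lborel (\<lambda>u. indicator {b..d} u *\<^sub>R (w' u * ?Q u))"
        by (intro borel_integrable_compact continuous_intros cw' compact_Icc)
      show "integrable lborel (\<lambda>u. indicator {b..d} u *\<^sub>R (K' * (L + 2)))"
        by (intro borel_integrable_compact continuous_intros compact_Icc)
      show "norm (indicator {b..d} u *\<^sub>R (w' u * ?Q u)) \<le> indicator {b..d} u *\<^sub>R (K' * (L + 2))"
        for u
        using K'[of u] Q[of u] bd K'0
        by (auto simp: indicator_def norm_mult intro!: mult_mono)
    qed
    also have "\<dots> = (d - b) * (K' * (L + 2))"
      using bd by (simp add: set_lebesgue_integral_def)
    also have "\<dots> \<le> (2 * L) * (K' * (L + 2))"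
      using bd L K'0 by (intro mult_right_mono) auto
    finally have "norm (LINT u:{b..d}|lborel. w' u * ?Q u) \<le> (2 * L) * (K' * (L + 2))" .
    moreover have "norm (w u * ?Q u) \<le> K * (L + 2)" if "u \<in> {-L..L}" for u
      unfolding norm_mult using K Q K0 that by (intro mult_mono) auto
    then have "norm (w d * ?Q d) \<le> K * (L + 2)" "norm (w b * ?Q b) \<le> K * (L + 2)"
      using bd by auto
    ultimately show ?thesis
      unfolding set_integral_by_parts_dirichlet[OF bd(2) w w'] C_def
      by (smt (verit) norm_triangle_ineq4)
  qed
  then show ?thesis using that by blast
qed

lemma AE_lborel_not_Ints: "AE u in lborel. (u::real) \<notin> \<int>"
proof -
  have "countable (\<int> :: real set)"
    unfolding Ints_def by auto
  then have "\<int> \<in> null_sets (lborel :: real measure)"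
    by (rule countable_imp_null_set_lborel)
  then show ?thesis by (rule AE_not_in)
qed

text \<open>
  Integer endpoints are excluded: there the primitive converges to the mean of the two one-sided
  limits, and an endpoint would be counted with weight one half.
\<close>

lemma dirichlet_integral_tendsto:
  fixes w w' :: "real \<Rightarrow> complex"
  assumes "b \<le> d" "b \<notin> \<int>" "d \<notin> \<int>"
    and w: "\<And>u. (w has_vector_derivative w' u) (at u)" and w': "continuous_on UNIV w'"
  shows "(\<lambda>R. LINT u:{b..d}|lborel. w u * of_real (dirichlet_kernel R u))
    \<longlonglongrightarrow> (\<Sum>j \<in> {\<lfloor>b\<rfloor> + 1..\<lfloor>d\<rfloor>}. w (of_int j))"
proof -
  define L where "L = max \<bar>b\<bar> \<bar>d\<bar>"
  have [measurable]: "w' \<in> borel_measurable borel"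
    by (rule borel_measurable_continuous_onI[OF w'])
  have "(\<lambda>R. LINT u:{b..d}|lborel. w' u * of_real (dirichlet_primitive R u))
    \<longlonglongrightarrow> (LINT u:{b..d}|lborel. w' u * of_real (of_int \<lfloor>u\<rfloor> + 1 / 2))"
    unfolding set_lebesgue_integral_def
  proof (rule integral_dominated_convergence)
    show "integrable lborel (\<lambda>u. indicator {b..d} u *\<^sub>R (norm (w' u) * (L + 2)))"
      by (intro borel_integrable_compact continuous_intros continuous_on_subset[OF w'] compact_Icc) auto
    show "AE u in lborel. (\<lambda>R. indicator {b..d} u *\<^sub>R (w' u * of_real (dirichlet_primitive R u)))
        \<longlonglongrightarrow> indicator {b..d} u *\<^sub>R (w' u * of_real (of_int \<lfloor>u\<rfloor> + 1 / 2))"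
      using AE_lborel_not_Ints
      by eventually_elim (intro tendsto_intros dirichlet_primitive_tendsto)
    show "AE u in lborel. norm (indicator {b..d} u *\<^sub>R (w' u * of_real (dirichlet_primitive R u)))
        \<le> indicator {b..d} u *\<^sub>R (norm (w' u) * (L + 2))" for R
      using dirichlet_primitive_abs_bound[of _ L R]
      by (intro AE_I2) (auto simp: indicator_def norm_mult L_def intro!: mult_left_mono)
  qed measurable
  then show ?thesis
    unfolding set_integral_by_parts_dirichlet[OF \<open>b \<le> d\<close> w w']
      euler_summation[OF \<open>b \<le> d\<close> w w', symmetric]
    by (intro tendsto_intros dirichlet_primitive_tendsto assms)
qed

section \<open>Poisson summation for functions whose level sets are intervals\<close>

text \<open>
  Poisson summation for \<open>f * w\<close>, with the symmetric partial sums of the Fourier side written as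
  integrals against the Dirichlet kernel. Since \<open>f u\<close> is the length of the set of \<open>y > 0\<close> below
  \<open>f u\<close>, Fubini's theorem reduces the claim to the functions \<open>w\<close> restricted to the level sets
  \<open>{b<..<d}\<close> of \<open>f\<close>. The values \<open>f b = f d = y\<close> at the endpoints ensure that an integer endpoint
  occurs only for the countably many levels \<open>y\<close> that are values of \<open>f\<close> at integers; this null set
  of levels does not affect the integral over \<open>y\<close>.
\<close>

lemma poisson_summation_level_intervals:
  fixes f :: "real \<Rightarrow> real" and w w' :: "real \<Rightarrow> complex" and J :: "int set"
  assumes f: "continuous_on UNIV f" "\<And>u. 0 \<le> f u" "\<And>u. f u \<le> 1"
    and levels: "\<And>y. 0 < y \<Longrightarrow> y < 1 \<Longrightarrow>
      \<exists>b d. - L \<le> b \<and> b \<le> d \<and> d \<le> L \<and> {u. y < f u} = {b<..<d} \<and> f b = y \<and> f d = y"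
    and w: "\<And>u. (w has_vector_derivative w' u) (at u)" and w': "continuous_on UNIV w'"
    and J: "finite J" "\<And>j. f (of_int j) \<noteq> 0 \<Longrightarrow> j \<in> J"
  shows "(\<lambda>R. LINT u:{-L..L}|lborel. of_real (f u) * (w u * of_real (dirichlet_kernel R u)))
    \<longlonglongrightarrow> (\<Sum>j\<in>J. of_real (f (of_int j)) * w (of_int j))"
proof -
  have cw: "continuous_on A w" for A
    using w by (meson continuous_at_imp_continuous_on has_vector_derivative_continuous)
  have [measurable]: "f \<in> borel_measurable borel" "w \<in> borel_measurable borel"
    by (intro borel_measurable_continuous_onI f cw)+
  define k where "k R u = w u * complex_of_real (dirichlet_kernel R u)" for R u
  have [measurable]: "k R \<in> borel_measurable borel" for R
    unfolding k_def by measurable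
  have ck: "continuous_on A (k R)" for A R
    unfolding k_def by (intro continuous_intros cw)
  define h where "h R u y = (if 0 < y \<and> y < f u then indicator {-L..L} u *\<^sub>R k R u else 0)" for R u y
  have int_y: "(LINT y|lborel. (if 0 < y \<and> y < f u then c else 0)) = of_real (f u) * c"
    and has_int_y: "integrable lborel (\<lambda>y. if 0 < y \<and> y < f u then c else 0)"
    for u and c :: complex
  proof -
    have *: "(\<lambda>y. if 0 < y \<and> y < f u then c else 0) = (\<lambda>y. indicator {0<..<f u} y *\<^sub>R c)"
      by (auto simp: indicator_def)
    show "(LINT y|lborel. (if 0 < y \<and> y < f u then c else 0)) = of_real (f u) * c"
      unfolding * using f(2)[of u] by (simp add: scaleR_conv_of_real)
    show "integrable lborel (\<lambda>y. if 0 < y \<and> y < f u then c else 0)"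
      unfolding * using f(2)[of u]
      by (intro integrable_scaleR_left integrable_real_indicator) (auto simp: less_top[symmetric])
  qed
  have fubini: "(LINT u:{-L..L}|lborel. of_real (f u) * k R u) = (LINT y|lborel. LINT u|lborel. h R u y)" for R
  proof -
    have "bounded (k R ` {-L..L})"
      by (intro compact_imp_bounded compact_continuous_image ck compact_Icc)
    then obtain K where K: "\<And>u. u \<in> {-L..L} \<Longrightarrow> norm (k R u) \<le> K"
      unfolding bounded_iff by blast
    have h_le: "norm (h R u y) \<le> max K 0" for u y
      using K[of u] by (auto simp: h_def indicator_def)
    have h_outside: "h R u y = 0" if "u \<notin> {-L..L} \<or> y \<notin> {0..1}" for u y
      using that f(3)[of u] by (auto simp: h_def indicator_def)
    have "integrable (lborel \<Otimes>\<^sub>M lborel) (case_prod (h R))"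
    proof (rule integrableI_bounded_set)
      show "{-L..L} \<times> {0..1} \<in> sets (lborel \<Otimes>\<^sub>M lborel :: (real \<times> real) measure)"
        by (intro pair_measureI) auto
      show "case_prod (h R) \<in> borel_measurable (lborel \<Otimes>\<^sub>M lborel)"
        unfolding h_def by measurable
      show "emeasure (lborel \<Otimes>\<^sub>M lborel) ({-L..L} \<times> {0..1::real}) < \<infinity>"
        by (subst lborel.emeasure_pair_measure_Times) (auto simp: emeasure_lborel_Icc_eq ennreal_mult_less_top)
      show "AE x in lborel \<Otimes>\<^sub>M lborel. x \<in> {-L..L} \<times> {0..1} \<longrightarrow> norm (case_prod (h R) x) \<le> max K 0"
        using h_le by (intro AE_I2) (simp add: case_prod_beta)
      show "AE x in lborel \<Otimes>\<^sub>M lborel. x \<notin> {-L..L} \<times> {0..1} \<longrightarrow> case_prod (h R) x = 0"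
      proof (intro AE_I2 impI)
        fix x :: "real \<times> real" assume "x \<notin> {-L..L} \<times> {0..1}"
        then show "case_prod (h R) x = 0"
          using h_outside[of "fst x" "snd x"] by (simp add: mem_Times_iff case_prod_beta)
      qed
    qed
    from lborel_pair.Fubini_integral[OF this]
    have "(LINT y|lborel. LINT u|lborel. h R u y) = (LINT u|lborel. LINT y|lborel. h R u y)" .
    also have "\<dots> = (LINT u:{-L..L}|lborel. of_real (f u) * k R u)"
      unfolding h_def int_y set_lebesgue_integral_def by (simp add: scaleR_conv_of_real algebra_simps)
    finally show ?thesis by simp
  qed
  have slice: "(LINT u|lborel. h R u y) = (LINT u:{b..d}|lborel. k R u)"
    if y: "0 < y" and bd: "- L \<le> b" "d \<le> L" "{u. y < f u} = {b<..<d}" for R y b d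
    unfolding set_lebesgue_integral_def
  proof (rule integral_cong_AE)
    show "AE u in lborel. h R u y = indicator {b..d} u *\<^sub>R k R u"
      using AE_lborel_singleton[of b] AE_lborel_singleton[of d]
    proof eventually_elim
      case (elim u)
      have "y < f u \<longleftrightarrow> u \<in> {b..d}"
        using eqset_imp_iff[OF bd(3), of u] elim by auto
      then show ?case using y bd(1,2) by (auto simp: h_def indicator_def)
    qed
  qed (unfold h_def, measurable)
  obtain C where C: "\<And>R b d. -L \<le> b \<Longrightarrow> b \<le> d \<Longrightarrow> d \<le> L \<Longrightarrow>
      norm (LINT u:{b..d}|lborel. k R u) \<le> C"
    using dirichlet_integral_bounded[OF w w'] unfolding k_def by metis
  have outside: "h R u y = 0" if "y \<notin> {0<..<1}" for R u y
    using that f(3)[of u] by (auto simp: h_def)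
  have "(\<lambda>R. LINT y|lborel. LINT u|lborel. h R u y)
      \<longlonglongrightarrow> (LINT y|lborel. (\<Sum>j\<in>J. if 0 < y \<and> y < f (of_int j) then w (of_int j) else 0))"
  proof (rule integral_dominated_convergence)
    show "integrable lborel (\<lambda>y. indicator {0<..<1::real} y *\<^sub>R C)"
      by (intro integrable_scaleR_left integrable_real_indicator) auto
    show "AE y in lborel. norm (LINT u|lborel. h R u y) \<le> indicator {0<..<1} y *\<^sub>R C" for R
    proof (intro AE_I2)
      fix y :: real
      show "norm (LINT u|lborel. h R u y) \<le> indicator {0<..<1} y *\<^sub>R C"
      proof (cases "y \<in> {0<..<1}")
        case True
        then obtain b d where "- L \<le> b" "b \<le> d" "d \<le> L" "{u. y < f u} = {b<..<d}"
          using levels[of y] by auto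
        then show ?thesis using True C slice by simp
      qed (simp add: outside)
    qed
    \<comment> \<open>A null set that contains every level whose interval has an integer endpoint.\<close>
    have "countable (range (\<lambda>j::int. f (of_int j)))" by auto
    from AE_not_in[OF countable_imp_null_set_lborel[OF this]]
    show "AE y in lborel. (\<lambda>R. LINT u|lborel. h R u y)
      \<longlonglongrightarrow> (\<Sum>j\<in>J. if 0 < y \<and> y < f (of_int j) then w (of_int j) else 0)"
    proof eventually_elim
      case (elim y)
      show ?case
      proof (cases "y \<in> {0<..<1}")
        case True
        then obtain b d where bd: "- L \<le> b" "b \<le> d" "d \<le> L" "{u. y < f u} = {b<..<d}"
          "f b = y" "f d = y"
          using levels[of y] by auto
        have not_int: "b \<notin> \<int>" "d \<notin> \<int>"
          using bd(5,6) elim by (metis Ints_cases rangeI)+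
        have "(\<Sum>j\<in>{\<lfloor>b\<rfloor> + 1..\<lfloor>d\<rfloor>}. w (of_int j))
            = (\<Sum>j\<in>J. if 0 < y \<and> y < f (of_int j) then w (of_int j) else 0)"
        proof (rule sum.mono_neutral_cong)
          have "y < f (of_int j) \<longleftrightarrow> j \<in> {\<lfloor>b\<rfloor> + 1..\<lfloor>d\<rfloor>}" for j
          proof -
            have "of_int j \<noteq> d" using not_int by auto
            then have "j \<in> {\<lfloor>b\<rfloor> + 1..\<lfloor>d\<rfloor>} \<longleftrightarrow> of_int j \<in> {b<..<d}"
              by (auto simp: le_floor_iff) linarith+
            then show ?thesis using eqset_imp_iff[OF bd(4), of "of_int j"] by simp
          qed
          note mem = this
          show "w (of_int j) = (if 0 < y \<and> y < f (of_int j) then w (of_int j) else 0)"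
            if "j \<in> {\<lfloor>b\<rfloor> + 1..\<lfloor>d\<rfloor>} \<inter> J" for j
            using that mem True by auto
          show "(if 0 < y \<and> y < f (of_int j) then w (of_int j) else 0) = 0"
            if "j \<in> J - {\<lfloor>b\<rfloor> + 1..\<lfloor>d\<rfloor>}" for j
            using that mem by auto
          show "w (of_int j) = 0" if "j \<in> {\<lfloor>b\<rfloor> + 1..\<lfloor>d\<rfloor>} - J" for j
            using that mem[of j] J(2)[of j] True by auto
        qed (use J in auto)
        then show ?thesis
          using dirichlet_integral_tendsto[OF bd(2) not_int w w'] slice[of y b d] True bd
          by (simp add: k_def)
      next
        case False
        have "\<not> (0 < y \<and> y < f u)" for u
          using False f(3)[of u] by auto
        then have "(\<Sum>j\<in>J. if 0 < y \<and> y < f (of_int j) then w (of_int j) else 0) = 0"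
          by (simp only: if_False sum.neutral_const)
        with False show ?thesis by (simp add: outside)
      qed
    qed
    show "(\<lambda>y. LINT u|lborel. h R u y) \<in> borel_measurable lborel" for R
      unfolding h_def by measurable
  qed measurable
  also have "(LINT y|lborel. (\<Sum>j\<in>J. if 0 < y \<and> y < f (of_int j) then w (of_int j) else 0))
      = (\<Sum>j\<in>J. of_real (f (of_int j)) * w (of_int j))"
    by (simp add: Bochner_Integration.integral_sum has_int_y int_y)
  finally show ?thesis
    using fubini unfolding k_def by simp
qed

section \<open>Window functions\<close>

text \<open>
  The support condition of the definition bounds the window only by the closed interval. The endpoints
  are excluded because the set where a continuous function is nonzero is open.
\<close>

lemma window_vanishes:
  assumes "\<phi> \<in> windows m N N1" "N1 > 0" "m > 0" "t \<notin> window_interval m N1"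
  shows "\<phi> t = 0"
proof -
  let ?L = "real m / real N1"
  have "open (\<phi> -` (- {0}))"
    using assms(1) by (intro continuous_open_vimage)
      (auto simp: windows_def continuous_on_eq_continuous_at)
  moreover have "\<phi> -` (- {0}) = {t. \<phi> t \<noteq> 0}" by auto
  moreover have "{t. \<phi> t \<noteq> 0} \<subseteq> closure (window_interval m N1)"
    using assms(1) closure_subset[of "{t. \<phi> t \<noteq> 0}"] by (simp add: windows_def)
  moreover have "closure (window_interval m N1) = {- ?L..?L}"
    using assms(2,3) unfolding window_interval_def by (intro closure_greaterThanLessThan) auto
  ultimately have "{t. \<phi> t \<noteq> 0} \<subseteq> {- ?L<..<?L}"
    using interior_maximal[of "{t. \<phi> t \<noteq> 0}" "{- ?L..?L}"] by simp
  then show ?thesis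
    using assms(4) unfolding window_interval_def by blast
qed

text \<open>
  The window may be constant on intervals, so a level can be attained many times; the endpoint of the
  level set is the smallest nonnegative point where it is attained.
\<close>

lemma window_level_set:
  assumes \<phi>: "\<phi> \<in> windows m N N1" and "N1 > 0" "m > 0" and y: "0 < y" "y < 1"
  obtains a where "0 \<le> a" "a \<le> real m / real N1" "\<phi> a = y" "{t. y < \<phi> t} = {-a<..<a}"
proof -
  let ?L = "real m / real N1"
  have even: "\<phi> (- t) = \<phi> t" and \<phi>0: "\<phi> 0 = 1" and anti: "antimono_on {0..?L} \<phi>"
    and cont: "continuous_on UNIV \<phi>" for t
    using \<phi> by (auto simp: windows_def)
  have vanish: "\<phi> t = 0" if "t \<ge> ?L" for t
    using window_vanishes[OF \<phi> \<open>N1 > 0\<close> \<open>m > 0\<close>, of t] that by (auto simp: window_interval_def)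
  define T where "T = {0..?L} \<inter> \<phi> -` {y}"
  have "\<exists>t. 0 \<le> t \<and> t \<le> ?L \<and> \<phi> t = y"
    using y \<phi>0 vanish[of ?L] by (intro IVT2' continuous_on_subset[OF cont]) auto
  then have "T \<noteq> {}" by (auto simp: T_def)
  moreover have "compact T"
    unfolding T_def by (intro compact_Int_closed compact_Icc closed_vimage cont) auto
  ultimately obtain a where a: "a \<in> T" and a_min: "\<And>t. t \<in> T \<Longrightarrow> a \<le> t"
    by (meson compact_attains_inf)
  have aT: "0 \<le> a" "a \<le> ?L" "\<phi> a = y"
    using a by (auto simp: T_def)
  have pos: "y < \<phi> t \<longleftrightarrow> t < a" if "0 \<le> t" for t
  proof
    assume "t < a"
    then have "y \<le> \<phi> t" "\<phi> t \<noteq> y"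
      using monotone_onD[OF anti, of t a] a_min[of t] aT that by (force simp: T_def)+
    then show "y < \<phi> t" by simp
  next
    assume *: "y < \<phi> t"
    then have "t \<le> ?L" using vanish[of t] y by linarith
    then have "\<phi> t \<le> y" if "a \<le> t"
      using monotone_onD[OF anti, of a t] aT that by auto
    with * show "t < a" by linarith
  qed
  have level: "y < \<phi> t \<longleftrightarrow> \<bar>t\<bar> < a" for t
    using pos[of "\<bar>t\<bar>"] even[of t] by (cases "0 \<le> t") auto
  have "{t. y < \<phi> t} = {-a<..<a}"
    unfolding level by (auto simp: abs_less_iff)
  with aT show ?thesis by (rule that)
qed

section \<open>The aliasing series\<close>

text \<open>
  The substitution \<open>t = x - u / N1\<close> moves the points \<open>x - j / N1\<close> to the integers. It splits the
  exponential of frequency \<open>r * N1\<close> in \<open>t\<close> into one of frequency \<open>r\<close> in \<open>u\<close> and a constant, which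
  the factor \<open>cis (2 * pi * r * N1 * x)\<close> cancels.
\<close>

lemma fourier_hat_shift:
  assumes \<phi>: "\<phi> \<in> windows m N N1" and N1: "N1 > 0" and m: "m > 0"
    and L: "real N1 * \<bar>x\<bar> + real m \<le> L"
  shows "fourier_hat m N1 \<phi> (of_int (n + r * int N1)) * cis (2 * pi * of_int r * real N1 * x)
    = cis (- 2 * pi * of_int n * x) / of_nat N1
      * (LINT u:{-L..L}|lborel. of_real (\<phi> (x - u / real N1))
          * (cis (2 * pi * of_int n * u / real N1) * cis (2 * pi * of_int r * u)))"
proof -
  let ?v = "of_int (n + r * int N1) :: real"
  let ?e = "\<lambda>t. cis (- 2 * pi * ?v * t)"
  have vanish: "\<phi> t = 0" if "t \<notin> window_interval m N1" for t
    by (rule window_vanishes[OF \<phi> N1 m that])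
  have "fourier_hat m N1 \<phi> ?v = (LINT t|lborel. of_real (\<phi> t) * ?e t)"
    unfolding fourier_hat_def set_lebesgue_integral_def using vanish
    by (intro Bochner_Integration.integral_cong) (auto simp: indicator_def)
  also have "\<dots> = (LINT u|lborel. of_real (\<phi> (x - u / real N1)) * ?e (x - u / real N1)) / of_nat N1"
    using N1 by (subst lborel_integral_real_affine[of "- 1 / real N1" _ x])
      (auto simp: scaleR_conv_of_real)
  also have "(LINT u|lborel. of_real (\<phi> (x - u / real N1)) * ?e (x - u / real N1))
      = (LINT u:{-L..L}|lborel. of_real (\<phi> (x - u / real N1)) * ?e (x - u / real N1))"
    unfolding set_lebesgue_integral_def
  proof (intro Bochner_Integration.integral_cong refl)
    fix u
    have "\<phi> (x - u / real N1) = 0" if "u \<notin> {-L..L}"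
    proof (rule vanish)
      have "real N1 * (x - u / real N1) = real N1 * x - u"
        using N1 by (simp add: right_diff_distrib)
      then have "real N1 * \<bar>x - u / real N1\<bar> = \<bar>real N1 * x - u\<bar>"
        by (metis abs_mult abs_of_nat)
      moreover have "real N1 * \<bar>x\<bar> = \<bar>real N1 * x\<bar>" by (simp add: abs_mult)
      ultimately have "real N1 * \<bar>x - u / real N1\<bar> \<ge> real m"
        using that L by (auto simp: abs_if split: if_splits)
      then have "\<bar>x - u / real N1\<bar> \<ge> real m / real N1"
        using N1 by (simp add: field_simps)
      then show "x - u / real N1 \<notin> window_interval m N1"
        by (auto simp: window_interval_def)
    qed
    then show "of_real (\<phi> (x - u / real N1)) * ?e (x - u / real N1)
        = indicator {-L..L} u *\<^sub>R (of_real (\<phi> (x - u / real N1)) * ?e (x - u / real N1))"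
      by (auto simp: indicator_def)
  qed
  finally have "fourier_hat m N1 \<phi> ?v * cis (2 * pi * of_int r * real N1 * x)
    = (LINT u:{-L..L}|lborel. (of_real (\<phi> (x - u / real N1)) * ?e (x - u / real N1))
        * cis (2 * pi * of_int r * real N1 * x)) / of_nat N1"
    by simp
  also have "(\<lambda>u. (of_real (\<phi> (x - u / real N1)) * ?e (x - u / real N1))
        * cis (2 * pi * of_int r * real N1 * x))
      = (\<lambda>u. cis (- 2 * pi * of_int n * x) * (of_real (\<phi> (x - u / real N1))
          * (cis (2 * pi * of_int n * u / real N1) * cis (2 * pi * of_int r * u))))"
  proof
    fix u
    have "- 2 * pi * ?v * (x - u / real N1) + 2 * pi * of_int r * real N1 * x
      = - 2 * pi * of_int n * x + (2 * pi * of_int n * u / real N1 + 2 * pi * of_int r * u)"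
      using N1 by (simp add: field_simps)
    then have "?e (x - u / real N1) * cis (2 * pi * of_int r * real N1 * x)
      = cis (- 2 * pi * of_int n * x)
        * (cis (2 * pi * of_int n * u / real N1) * cis (2 * pi * of_int r * u))"
      by (simp only: cis_mult)
    then show "(of_real (\<phi> (x - u / real N1)) * ?e (x - u / real N1))
        * cis (2 * pi * of_int r * real N1 * x)
      = cis (- 2 * pi * of_int n * x) * (of_real (\<phi> (x - u / real N1))
          * (cis (2 * pi * of_int n * u / real N1) * cis (2 * pi * of_int r * u)))"
      by (simp only: mult.assoc) (simp only: mult.left_commute)
  qed
  finally show ?thesis by simp
qed

text \<open>
  The limit is that of \<open>poisson_summation_level_intervals\<close> for the dilated window
  \<open>\<phi> (x - u / N1)\<close>, whose level sets are the intervals centred at \<open>N1 * x\<close>, and the exponential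
  of frequency \<open>n / N1\<close>. The set \<open>J\<close> makes the sum over
  all integers a finite one.
\<close>

lemma window_poisson_summation:
  assumes \<phi>: "\<phi> \<in> windows m N N1" and N1: "N1 > 0" and m: "m > 0"
    and J: "finite J" "\<And>j. \<phi> (x - of_int j / real N1) \<noteq> 0 \<Longrightarrow> j \<in> J"
  shows "(\<lambda>R. \<Sum>r \<in> {- int R..int R}. fourier_hat m N1 \<phi> (of_int (n + r * int N1))
        * cis (2 * pi * of_int r * real N1 * x))
    \<longlonglongrightarrow> cis (- 2 * pi * of_int n * x) / of_nat N1
      * (\<Sum>j\<in>J. of_real (\<phi> (x - of_int j / real N1)) * cis (2 * pi * of_int n * of_int j / real N1))"
proof -
  define L where "L = real N1 * \<bar>x\<bar> + real m"
  define f where "f u = \<phi> (x - u / real N1)" for u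
  define w where "w u = cis (2 * pi * of_int n * u / real N1)" for u
  define \<omega> where "\<omega> = 2 * pi * of_int n / real N1"
  have w_alt: "w u = cis (\<omega> * u)" for u
    by (simp add: w_def \<omega>_def)
  have cont_\<phi>: "continuous_on UNIV \<phi>" and range_\<phi>: "range \<phi> \<subseteq> {0..1}"
    and even: "\<phi> (- t) = \<phi> t" for t
    using \<phi> by (auto simp: windows_def)
  have f01: "0 \<le> f u" "f u \<le> 1" for u
    using range_\<phi> by (auto simp: f_def image_subset_iff)
  have cf: "continuous_on A f" for A
    unfolding f_def using N1
    by (intro continuous_on_compose2[OF cont_\<phi>] continuous_intros) auto
  have dw: "(w has_vector_derivative (\<i> * of_real \<omega> * cis (\<omega> * u))) (at u)" for u
  proof -
    have "((\<lambda>u. cis (\<omega> * u)) has_vector_derivative (\<i> * of_real \<omega> * cis (\<omega> * u))) (at u)"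
      unfolding has_vector_derivative_def
      by (rule derivative_eq_intros refl | simp add: fun_eq_iff scaleR_conv_of_real mult_ac)+
    then show ?thesis by (simp add: w_alt[abs_def])
  qed
  have cw: "continuous_on A (\<lambda>u. \<i> * of_real \<omega> * cis (\<omega> * u))" for A
    by (intro continuous_intros)
  have cw': "continuous_on A w" for A
    unfolding w_alt by (intro continuous_intros)
  have levels: "\<exists>b d. - L \<le> b \<and> b \<le> d \<and> d \<le> L \<and> {u. y < f u} = {b<..<d} \<and> f b = y \<and> f d = y"
    if y: "0 < y" "y < 1" for y
  proof -
    obtain a where a: "0 \<le> a" "a \<le> real m / real N1" "\<phi> a = y" "{t. y < \<phi> t} = {-a<..<a}"
      using window_level_set[OF \<phi> N1 m y] by blast
    define b where "b = real N1 * (x - a)"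
    define d where "d = real N1 * (x + a)"
    have "real N1 * a \<le> real m" using a(2) N1 by (simp add: field_simps)
    moreover have "\<bar>real N1 * x\<bar> = real N1 * \<bar>x\<bar>" by (simp add: abs_mult)
    ultimately have "- L \<le> b" "d \<le> L"
      unfolding b_def d_def L_def right_diff_distrib distrib_left by linarith+
    moreover have "b \<le> d" unfolding b_def d_def using a(1) by (intro mult_left_mono) auto
    moreover have "y < f u \<longleftrightarrow> u \<in> {b<..<d}" for u
      using eqset_imp_iff[OF a(4), of "x - u / real N1"] N1
      by (auto simp: f_def b_def d_def field_simps)
    then have "{u. y < f u} = {b<..<d}" by blast
    moreover have "f b = y" "f d = y"
      using a(3) even[of a] N1 by (simp_all add: f_def b_def d_def)
    ultimately show ?thesis by blast
  qed
  have main: "(\<lambda>R. LINT u:{-L..L}|lborel. of_real (f u) * (w u * of_real (dirichlet_kernel R u)))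
    \<longlonglongrightarrow> (\<Sum>j\<in>J. of_real (f (of_int j)) * w (of_int j))"
    by (rule poisson_summation_level_intervals[OF cf f01 levels dw cw J(1)])
       (use J(2) in \<open>auto simp: f_def\<close>)
  have sums: "(\<Sum>r \<in> {- int R..int R}. fourier_hat m N1 \<phi> (of_int (n + r * int N1))
        * cis (2 * pi * of_int r * real N1 * x))
      = cis (- 2 * pi * of_int n * x) / of_nat N1
        * (LINT u:{-L..L}|lborel. of_real (f u) * (w u * of_real (dirichlet_kernel R u)))" for R
  proof -
    have "(\<Sum>r \<in> {- int R..int R}. fourier_hat m N1 \<phi> (of_int (n + r * int N1))
        * cis (2 * pi * of_int r * real N1 * x))
      = cis (- 2 * pi * of_int n * x) / of_nat N1 * (\<Sum>r \<in> {- int R..int R}.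
          LINT u:{-L..L}|lborel. of_real (f u) * (w u * cis (2 * pi * of_int r * u)))"
      unfolding sum_distrib_left f_def w_def
      by (intro sum.cong refl fourier_hat_shift[OF \<phi> N1 m]) (simp add: L_def)
    also have "(\<Sum>r \<in> {- int R..int R}.
          LINT u:{-L..L}|lborel. of_real (f u) * (w u * cis (2 * pi * of_int r * u)))
      = (LINT u:{-L..L}|lborel. (\<Sum>r \<in> {- int R..int R}.
          of_real (f u) * (w u * cis (2 * pi * of_int r * u))))"
      unfolding set_lebesgue_integral_def scaleR_sum_right
      by (rule Bochner_Integration.integral_sum[symmetric])
         (intro borel_integrable_compact continuous_intros cf cw' compact_Icc)
    finally show ?thesis
      by (simp only: sum_distrib_left[symmetric] sum_cis_symmetric)
  qed
  show ?thesis
    using tendsto_mult[OF tendsto_const[of "cis (- 2 * pi * of_int n * x) / of_nat N1"] main]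
    unfolding sums f_def w_def .
qed

lemma aliasing_series_eq:
  assumes \<phi>: "\<phi> \<in> windows m N N1" and N1: "N1 > 0" and m: "m > 0"
    and nz: "fourier_hat m N1 \<phi> (of_int n) \<noteq> 0"
    and J: "finite J" "\<And>j. \<phi> (x - of_int j / real N1) \<noteq> 0 \<Longrightarrow> j \<in> J"
  shows "aliasing_series m N1 \<phi> n x
    = cis (- 2 * pi * of_int n * x) / (of_nat N1 * fourier_hat m N1 \<phi> (of_int n))
      * (\<Sum>j\<in>J. of_real (\<phi> (x - of_int j / real N1)) * cis (2 * pi * of_int n * of_int j / real N1))
      - 1"
proof -
  let ?F = "\<lambda>r. fourier_hat m N1 \<phi> (of_int (n + r * int N1))"
  let ?e = "\<lambda>r. cis (2 * pi * of_int r * real N1 * x)"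
  let ?G = "fourier_hat m N1 \<phi> (of_int n)"
  let ?S = "\<Sum>j\<in>J. of_real (\<phi> (x - of_int j / real N1)) * cis (2 * pi * of_int n * of_int j / real N1)"
  have "(\<Sum>r \<in> {- int R..int R} - {0}. ?F r / ?G * ?e r)
      = (\<Sum>r \<in> {- int R..int R}. ?F r * ?e r) / ?G - 1" for R
    using nz by (simp add: sum_diff1 sum_divide_distrib)
  then have "(\<lambda>R. \<Sum>r \<in> {- int R..int R} - {0}. ?F r / ?G * ?e r)
      \<longlonglongrightarrow> cis (- 2 * pi * of_int n * x) / of_nat N1 * ?S / ?G - 1"
    using nz by (simp only:) (intro tendsto_intros window_poisson_summation[OF \<phi> N1 m J])
  then show ?thesis
    unfolding aliasing_series_def by (subst limI) simp_all
qed

section \<open>Unfolding the periodization\<close>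

lemma finite_index_set: "finite (index_set N)"
  by (simp add: index_set_def)

text \<open>
  The representative of \<open>j\<close> modulo \<open>N1\<close> in the centred system \<open>index_set N1\<close>.
\<close>

definition residue_index :: "nat \<Rightarrow> int \<Rightarrow> int" where
  "residue_index N1 j = (j + int N1 div 2) mod int N1 - int N1 div 2"

lemma residue_index_in:
  assumes "N1 > 0" "even N1"
  shows "residue_index N1 j \<in> index_set N1"
proof -
  have "0 \<le> (j + int N1 div 2) mod int N1" "(j + int N1 div 2) mod int N1 < int N1"
    using assms by auto
  moreover have "int N1 = 2 * (int N1 div 2)" using assms by simp
  ultimately show ?thesis
    unfolding residue_index_def index_set_def by auto
qed

lemma residue_index_diff: "residue_index N1 j = j - (j + int N1 div 2) div int N1 * int N1"
  by (simp add: residue_index_def minus_div_mult_eq_mod[symmetric])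

lemma residue_index_class:
  assumes "N1 > 0" "even N1" "l \<in> index_set N1"
  shows "residue_index N1 (l - k * int N1) = l"
proof -
  have "int N1 = 2 * (int N1 div 2)" using assms by simp
  then have "(l + int N1 div 2) mod int N1 = l + int N1 div 2"
    using assms(3) unfolding index_set_def by (intro mod_pos_pos_trivial) auto
  moreover have "(l - k * int N1 + int N1 div 2) mod int N1 = (l + int N1 div 2) mod int N1"
    using mod_mult_self1[of "l + int N1 div 2" "- k" "int N1"] by (simp add: algebra_simps)
  ultimately show ?thesis by (simp add: residue_index_def)
qed

text \<open>
  The integer shift of \<open>x - l / N1\<close> by \<open>k\<close> is \<open>x - (l - k * N1) / N1\<close>, and \<open>l - k * N1\<close>
  runs through the residue class of \<open>l\<close>.
\<close>

lemma periodization_residue_class: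
  assumes N1: "N1 > 0" "even N1" and l: "l \<in> index_set N1"
    and J: "finite J" "\<And>j. \<phi> (x - of_int j / real N1) \<noteq> 0 \<Longrightarrow> j \<in> J"
  shows "periodization \<phi> (x - of_int l / real N1)
    = (\<Sum>j | j \<in> J \<and> residue_index N1 j = l. \<phi> (x - of_int j / real N1))"
proof -
  let ?g = "\<lambda>j. \<phi> (x - of_int j / real N1)"
  let ?s = "\<lambda>k. l - k * int N1"
  have inj: "inj ?s" using N1 by (auto simp: inj_on_def)
  have range: "range ?s = {j. residue_index N1 j = l}"
  proof (intro set_eqI iffI)
    fix j assume "j \<in> {j. residue_index N1 j = l}"
    then have "j = ?s (- ((j + int N1 div 2) div int N1))"
      using residue_index_diff[of N1 j] by simp
    then show "j \<in> range ?s" by blast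
  qed (use residue_index_class[OF N1 l] in auto)
  have "periodization \<phi> (x - of_int l / real N1) = (\<Sum>\<^sub>\<infinity>k. ?g (?s k))"
    unfolding periodization_def using N1 by (intro infsum_cong) (simp add: field_simps)
  also have "\<dots> = (\<Sum>\<^sub>\<infinity>j \<in> range ?s. ?g j)"
    using infsum_reindex[OF inj, of ?g] by (simp add: o_def)
  also have "\<dots> = (\<Sum>\<^sub>\<infinity>j \<in> {j \<in> J. residue_index N1 j = l}. ?g j)"
    unfolding range using J(2) by (intro infsum_cong_neutral) auto
  also have "\<dots> = (\<Sum>j | j \<in> J \<and> residue_index N1 j = l. ?g j)"
    using J(1) by (intro infsum_finite) auto
  finally show ?thesis .
qed

text \<open>
  The exponential depends only on the residue of its index modulo \<open>N1\<close>, and the residue classes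
  partition the integers, so the sum over nodes and shifts is one sum over all integers.
\<close>

lemma sum_periodization_unfold:
  assumes N1: "N1 > 0" "even N1"
    and J: "finite J" "\<And>j. \<phi> (x - of_int j / real N1) \<noteq> 0 \<Longrightarrow> j \<in> J"
  shows "(\<Sum>l \<in> index_set N1. cis (2 * pi * of_int n * of_int l / real N1)
        * complex_of_real (periodization \<phi> (x - of_int l / real N1)))
    = (\<Sum>j\<in>J. complex_of_real (\<phi> (x - of_int j / real N1)) * cis (2 * pi * of_int n * of_int j / real N1))"
proof -
  let ?t = "\<lambda>j. complex_of_real (\<phi> (x - of_int j / real N1)) * cis (2 * pi * of_int n * of_int j / real N1)"
  have phase: "cis (2 * pi * of_int n * of_int (residue_index N1 j) / real N1)
      = cis (2 * pi * of_int n * of_int j / real N1)" for j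
  proof -
    define q where "q = (j + int N1 div 2) div int N1"
    have "2 * pi * of_int n * of_int (residue_index N1 j) / real N1
      = 2 * pi * of_int n * of_int j / real N1 - 2 * pi * of_int (n * q)"
      using N1 by (simp add: residue_index_diff q_def field_simps)
    moreover have "cis (2 * pi * of_int (n * q)) = 1"
      by (rule cis_multiple_2pi) auto
    ultimately show ?thesis
      by (simp only: cis_divide[symmetric]) simp
  qed
  have "(\<Sum>l \<in> index_set N1. cis (2 * pi * of_int n * of_int l / real N1)
        * complex_of_real (periodization \<phi> (x - of_int l / real N1)))
      = (\<Sum>l \<in> index_set N1. \<Sum>j | j \<in> J \<and> residue_index N1 j = l. ?t j)"
    using phase
    by (intro sum.cong refl)
       (auto simp: periodization_residue_class[OF N1 _ J] sum_distrib_left mult.commute intro!: sum.cong)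
  also have "\<dots> = (\<Sum>j\<in>J. ?t j)"
    by (rule sum.group) (use J(1) residue_index_in[OF N1] in \<open>auto simp: finite_index_set\<close>)
  finally show ?thesis .
qed

section \<open>The error formula\<close>

text \<open>
  In the closed form of the aliasing series, the sum over \<open>j\<close> gives the contribution of the
  frequency \<open>n\<close> to \<open>s\<close> and \<open>- 1\<close> its contribution to \<open>- p\<close>, both up to the common factor
  \<open>c n * cis (2 * pi * n * x)\<close>.
\<close>

lemma nfft_error_eq:
  assumes \<phi>: "\<phi> \<in> windows m N N1" and N1: "N1 > 0" "even N1" and m: "m > 0"
    and nz: "\<And>n. n \<in> index_set N \<Longrightarrow> fourier_hat m N1 \<phi> (of_int n) \<noteq> 0"
  shows "nfft_approx m N N1 \<phi> c x - trig_poly N c x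
    = (\<Sum>n \<in> index_set N. c n * cis (2 * pi * of_int n * x) * aliasing_series m N1 \<phi> n x)"
proof -
  define J where "J = {j::int. \<phi> (x - of_int j / real N1) \<noteq> 0}"
  have "J \<subseteq> {\<lfloor>real N1 * x - real m\<rfloor>..\<lceil>real N1 * x + real m\<rceil>}"
  proof
    fix j assume "j \<in> J"
    then have "x - of_int j / real N1 \<in> window_interval m N1"
      using window_vanishes[OF \<phi> N1(1) m] unfolding J_def by blast
    then have "of_int j / real N1 < x + real m / real N1" "x - real m / real N1 < of_int j / real N1"
      by (auto simp: window_interval_def)
    then have "of_int j < real N1 * (x + real m / real N1)" "real N1 * (x - real m / real N1) < of_int j"
      using N1 by (simp_all add: divide_less_eq less_divide_eq mult.commute)
    moreover have "real N1 * (x + real m / real N1) = real N1 * x + real m"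
      "real N1 * (x - real m / real N1) = real N1 * x - real m"
      using N1 by (simp_all add: algebra_simps)
    ultimately have "of_int j < real N1 * x + real m" "real N1 * x - real m < of_int j"
      by simp_all
    then show "j \<in> {\<lfloor>real N1 * x - real m\<rfloor>..\<lceil>real N1 * x + real m\<rceil>}"
      by auto linarith+
  qed
  then have J: "finite J" "\<And>j. \<phi> (x - of_int j / real N1) \<noteq> 0 \<Longrightarrow> j \<in> J"
    using finite_subset by (auto simp: J_def)
  let ?S = "\<lambda>n. \<Sum>j\<in>J. of_real (\<phi> (x - of_int j / real N1)) * cis (2 * pi * of_int n * of_int j / real N1)"
  let ?F = "\<lambda>n. fourier_hat m N1 \<phi> (of_int n)"
  have "nfft_approx m N N1 \<phi> c x
      = (\<Sum>n \<in> index_set N. c n / (of_nat N1 * ?F n)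
          * (\<Sum>l \<in> index_set N1. cis (2 * pi * of_int n * of_int l / real N1)
              * complex_of_real (periodization \<phi> (x - of_int l / real N1))))"
    unfolding nfft_approx_def nfft_coeff_def sum_distrib_left sum_distrib_right
    by (subst sum.swap) (simp add: mult_ac)
  also have "\<dots> = (\<Sum>n \<in> index_set N. c n / (of_nat N1 * ?F n) * ?S n)"
    using sum_periodization_unfold[OF N1 J] by simp
  finally have "nfft_approx m N N1 \<phi> c x - trig_poly N c x
      = (\<Sum>n \<in> index_set N. c n / (of_nat N1 * ?F n) * ?S n - c n * cis (2 * pi * of_int n * x))"
    by (simp add: trig_poly_def sum_subtractf)
  also have "\<dots> = (\<Sum>n \<in> index_set N. c n * cis (2 * pi * of_int n * x) * aliasing_series m N1 \<phi> n x)"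
  proof (intro sum.cong refl)
    fix n assume n: "n \<in> index_set N"
    have aliasing: "aliasing_series m N1 \<phi> n x
        = cis (- 2 * pi * of_int n * x) / (of_nat N1 * ?F n) * ?S n - 1"
      using J by (intro aliasing_series_eq[OF \<phi> N1(1) m nz[OF n]])
    have expand: "c n * E * (E' / D * S - 1) = (E * E') * (c n / D * S) - c n * E"
      for E E' D S :: complex
      by (simp add: algebra_simps)
    have cancel: "cis (2 * pi * of_int n * x) * cis (- 2 * pi * of_int n * x) = 1"
      by (simp add: cis_mult)
    show "c n / (of_nat N1 * ?F n) * ?S n - c n * cis (2 * pi * of_int n * x)
        = c n * cis (2 * pi * of_int n * x) * aliasing_series m N1 \<phi> n x"
      unfolding aliasing expand cancel by simp
  qed
  finally show ?thesis .
qed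

theorem theorem2p1:
  fixes \<sigma> :: real and m :: nat and \<phi> :: "nat \<Rightarrow> real \<Rightarrow> real"
    and N :: nat and c :: "int \<Rightarrow> complex"
  assumes "\<sigma> > 1" and "m \<ge> 2"
    and "\<And>N'. admissible \<sigma> m N' \<Longrightarrow> \<phi> N' \<in> windows m N' (oversampled \<sigma> N')"
    and "admissible \<sigma> m N"
  shows "sup_norm (\<lambda>x. nfft_approx m N (oversampled \<sigma> N) (\<phi> N) c x - trig_poly N c x)
           \<le> error_const \<sigma> m \<phi> * ennreal (\<Sum>n \<in> index_set N. cmod (c n))"
proof -
  let ?N1 = "oversampled \<sigma> N"
  have \<phi>: "\<phi> N \<in> windows m N ?N1" using assms by blast
  obtain M where M: "M > 0" "even M" "real M = \<sigma> * real N"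
    using assms(4) unfolding admissible_def by blast
  have "?N1 = M"
    unfolding oversampled_def M(3)[symmetric] by simp
  then have N1: "?N1 > 0" "even ?N1" using M by auto
  have m: "m > 0" using assms(2) by simp
  have nz: "fourier_hat m ?N1 (\<phi> N) (of_int n) \<noteq> 0" if "n \<in> index_set N" for n
  proof -
    have "even N" using assms(4) by (simp add: admissible_def)
    then have "real N = 2 * of_int (int N div 2)"
      by (auto elim!: evenE)
    then have "(of_int n :: real) \<in> {- (real N / 2) .. real N / 2}"
      using that unfolding index_set_def by auto
    then have "Re (fourier_hat m ?N1 (\<phi> N) (of_int n)) > 0"
      using \<phi> unfolding windows_def by blast
    then show ?thesis by auto
  qed
  have alias_le: "ennreal (cmod (aliasing_series m ?N1 (\<phi> N) n x)) \<le> error_const \<sigma> m \<phi>"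
    if n: "n \<in> index_set N" for n x
  proof -
    have "ennreal (cmod (aliasing_series m ?N1 (\<phi> N) n x)) \<le> sup_norm (aliasing_series m ?N1 (\<phi> N) n)"
      unfolding sup_norm_def by (rule SUP_upper) simp
    also have "\<dots> \<le> error_const_N \<sigma> m N (\<phi> N)"
      unfolding error_const_N_def using n by (intro Max_ge) (auto simp: finite_index_set)
    also have "\<dots> \<le> error_const \<sigma> m \<phi>"
      unfolding error_const_def using assms(4) by (intro SUP_upper) simp
    finally show ?thesis .
  qed
  have error: "nfft_approx m N ?N1 (\<phi> N) c x - trig_poly N c x
      = (\<Sum>n \<in> index_set N. c n * cis (2 * pi * of_int n * x) * aliasing_series m ?N1 (\<phi> N) n x)"
    for x
    by (rule nfft_error_eq[OF \<phi> N1 m]) (rule nz)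
  show ?thesis
    unfolding sup_norm_def
  proof (rule SUP_least)
    fix x
    have "cmod (nfft_approx m N ?N1 (\<phi> N) c x - trig_poly N c x)
        \<le> (\<Sum>n \<in> index_set N. cmod (c n) * cmod (aliasing_series m ?N1 (\<phi> N) n x))"
      unfolding error
      by (rule order_trans[OF norm_sum]) (simp add: norm_mult)
    then have "ennreal (cmod (nfft_approx m N ?N1 (\<phi> N) c x - trig_poly N c x))
        \<le> (\<Sum>n \<in> index_set N. ennreal (cmod (c n)) * ennreal (cmod (aliasing_series m ?N1 (\<phi> N) n x)))"
      by (simp add: ennreal_leI flip: ennreal_mult)
    also have "\<dots> \<le> (\<Sum>n \<in> index_set N. ennreal (cmod (c n)) * error_const \<sigma> m \<phi>)"
      using alias_le by (intro sum_mono mult_left_mono) auto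
    also have "\<dots> = error_const \<sigma> m \<phi> * ennreal (\<Sum>n \<in> index_set N. cmod (c n))"
      by (simp add: sum_distrib_left mult.commute flip: sum_ennreal)
    finally show "ennreal (cmod (nfft_approx m N ?N1 (\<phi> N) c x - trig_poly N c x))
        \<le> error_const \<sigma> m \<phi> * ennreal (\<Sum>n \<in> index_set N. cmod (c n))" .
  qed
qed

end
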